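(* Let $d\ge40$ be an integer, let $\varepsilon\in(0,1)$, let $n\in\mathbb{N}$, and let $g_1,\dots,g_n$ be i.i.d. random vectors in $\mathbb{R}^d$ with $g_i\sim\mathcal{N}(0,I)$. Then there exists a $1$-Lipschitz function $f:\mathbb{R}\to\mathbb{R}$ such that, as long as $n\le(2\varepsilon)^{-2}d$, with probability at least $9/10$, $$\exists z\in\mathbb{R}^d \text{ with } \|z\|\le1:\qquad \left|\frac1n\sum_{i=1}^n f(\langle z,g_i\rangle)-\mathbb{E}_{Z\sim\mathcal{N}(0,\|z\|^2)}[f(Z)]\right|\ge\varepsilon .$$
   Context: $\|\cdot\|$ is the Euclidean norm; $\mathcal{N}(0,I)$ is the standard Gaussian distribution on $\mathbb{R}^d$; $\mathcal{N}(0,\sigma^2)$ is the Gaussian with mean $0$ and variance $\sigma^2$ (a point mass at $0$ if $\sigma=0$). *)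

theory Defs
  imports "HOL-Probability.Probability"
begin

definition std_gaussian :: "(real ^ 'd) measure" where
  "std_gaussian = density lborel
     (\<lambda>x. ennreal ((2 * pi) powr (- real CARD('d) / 2) * exp (- (norm x)\<^sup>2 / 2)))"

text \<open>The argument \<open>v\<close> is the variance, whereas \<^const>\<open>normal_density\<close> expects the
  standard deviation. Only \<open>v \<ge> 0\<close> is meaningful.\<close>

definition centered_gaussian :: "real \<Rightarrow> real measure" where
  "centered_gaussian v =
     (if v = 0 then return borel 0
      else density lborel (\<lambda>x. ennreal (normal_density 0 (sqrt v) x)))"

end

theory Submission
  imports Defs
begin

text \<open>Take \<open>f\<close> to be the identity. The expectation then vanishes, and the supremum over the unit
  ball of the remaining linear functional is \<open>\<parallel>S\<parallel> / n\<close>, where \<open>S\<close> is the sum of the \<open>g\<^sub>i\<close>. As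
  \<open>\<parallel>S\<parallel>\<^sup>2 / n\<close> has a \<open>\<chi>\<^sup>2\<close> distribution with \<open>d\<close> degrees of freedom, it falls below
  \<open>n \<epsilon>\<^sup>2 \<le> d / 4\<close> with exponentially small probability, by Chernoff's bound. The Laplace transform
  of \<open>\<parallel>S\<parallel>\<^sup>2\<close> is found without determining the law of \<open>S\<close>: writing \<open>exp (- a \<parallel>S\<parallel>\<^sup>2 / 2)\<close> as the
  average of \<open>exp (\<i> \<surd>a \<langle>h, S\<rangle>)\<close> over a standard Gaussian \<open>h\<close> and exchanging the two
  expectations, independence makes the inner one a product of characteristic functions.\<close>

section \<open>Coordinatewise factorisation of Gaussian integrals\<close>

lemma integral_lborel_prod:
  fixes F :: "'a::euclidean_space \<Rightarrow> real \<Rightarrow> 'b::{real_normed_field,banach,second_countable_topology}"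
  assumes "\<And>b. b \<in> Basis \<Longrightarrow> integrable lborel (F b)"
  shows "(\<integral>x. (\<Prod>b\<in>Basis. F b (x \<bullet> b)) \<partial>lborel) = (\<Prod>b\<in>Basis. \<integral>x. F b x \<partial>lborel)"
proof -
  interpret product_sigma_finite "\<lambda>_::'a. lborel :: real measure" ..
  have [measurable]: "F b \<in> borel_measurable borel" if "b \<in> Basis" for b
    using assms[OF that] by auto
  \<comment> \<open>\<open>lborel_eq\<close> presents Lebesgue measure as the image of a finite
    product of one-dimensional ones, so the product form of Fubini's theorem applies.\<close>
  have "(\<integral>x. (\<Prod>b\<in>Basis. F b (x \<bullet> b)) \<partial>lborel)
      = (\<integral>x. (\<Prod>b\<in>Basis. F b (x b)) \<partial>(\<Pi>\<^sub>M b\<in>(Basis :: 'a set). lborel))"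
    by (subst lborel_eq, subst integral_distr) (simp_all add: inner_sum_left_Basis)
  also have "\<dots> = (\<Prod>b\<in>Basis. \<integral>x. F b x \<partial>lborel)"
    using assms by (intro product_integral_prod) auto
  finally show ?thesis .
qed

text \<open>The squared norm is the sum of the squared coordinates, and the normalising constant is
  a \<open>CARD('d)\<close>-fold power. This reduces integrals over \<open>std_gaussian\<close> to
  one-dimensional ones.\<close>

lemma std_gaussian_eq_density_prod:
  "(std_gaussian :: (real ^ 'd) measure) =
    density lborel (\<lambda>x. ennreal (\<Prod>b\<in>Basis. std_normal_density (x \<bullet> b)))"
proof -
  have "(2 * pi) powr (- real CARD('d) / 2) * exp (- (norm x)\<^sup>2 / 2)
      = (\<Prod>b\<in>Basis. std_normal_density (x \<bullet> b))" for x :: "real ^ 'd"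
  proof -
    have "1 / sqrt (2 * pi) = (2 * pi) powr (- 1 / 2)"
      by (simp add: powr_half_sqrt[symmetric] powr_minus_divide)
    then have "(1 / sqrt (2 * pi)) ^ CARD('d) = (2 * pi) powr (- real CARD('d) / 2)"
      by (simp add: powr_powr flip: powr_realpow)
    moreover have "(norm x)\<^sup>2 = (\<Sum>b\<in>Basis. (x \<bullet> b)\<^sup>2)"
      unfolding power2_norm_eq_inner by (subst euclidean_inner) (simp add: power2_eq_square)
    then have "exp (- (norm x)\<^sup>2 / 2) = (\<Prod>b\<in>Basis. exp (- (x \<bullet> b)\<^sup>2 / 2))"
      by (simp add: exp_sum[symmetric] sum_divide_distrib sum_negf)
    ultimately show ?thesis
      by (simp only: std_normal_density_def prod.distrib prod_constant DIM_cart DIM_real mult_1_right)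
  qed
  then show ?thesis
    by (simp add: std_gaussian_def)
qed

lemma sets_std_gaussian [measurable_cong]: "sets std_gaussian = sets borel"
  by (simp add: std_gaussian_def)

text \<open>Independence of the coordinates of a Gaussian vector, in integral form. The codomain is
  general because both complex characteristic functions and real exponentials are integrated
  below.\<close>

lemma integral_std_gaussian_prod:
  fixes F :: "real ^ 'd \<Rightarrow> real \<Rightarrow> 'b::{real_normed_field,banach,second_countable_topology}"
  assumes "\<And>b. b \<in> Basis \<Longrightarrow> integrable std_normal_distribution (F b)"
  shows "(\<integral>x. (\<Prod>b\<in>Basis. F b (x \<bullet> b)) \<partial>std_gaussian)
    = (\<Prod>b\<in>Basis. \<integral>x. F b x \<partial>std_normal_distribution)"
proof -
  have F [measurable]: "F b \<in> borel_measurable borel" if "b \<in> Basis" for b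
    using borel_measurable_integrable[OF assms[OF that]] by simp
  have "(\<integral>x. (\<Prod>b\<in>Basis. F b (x \<bullet> b)) \<partial>std_gaussian)
      = (\<integral>x. (\<Prod>b\<in>Basis. std_normal_density (x \<bullet> b) *\<^sub>R F b (x \<bullet> b)) \<partial>lborel)"
    unfolding std_gaussian_eq_density_prod
    by (subst integral_density)
      (auto intro!: prod_nonneg simp: scaleR_conv_of_real prod.distrib)
  also have "\<dots> = (\<Prod>b\<in>Basis. \<integral>x. std_normal_density x *\<^sub>R F b x \<partial>lborel)"
    using assms F by (intro integral_lborel_prod) (simp add: integrable_density)
  also have "\<dots> = (\<Prod>b\<in>Basis. \<integral>x. F b x \<partial>std_normal_distribution)"
    using F by (intro prod.cong refl) (simp add: integral_density)
  finally show ?thesis .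
qed

lemma prob_space_std_gaussian: "prob_space std_gaussian"
proof
  have "emeasure (std_gaussian :: (real ^ 'a) measure) (space std_gaussian)
      = (\<integral>\<^sup>+x. (\<Prod>b\<in>Basis. ennreal (std_normal_density (x \<bullet> b))) \<partial>(lborel :: (real ^ 'a) measure))"
    unfolding std_gaussian_eq_density_prod by (simp add: emeasure_density prod_ennreal)
  also have "\<dots> = 1"
    by (subst nn_integral_lborel_prod) (simp_all add: nn_integral_eq_integral)
  finally show "emeasure (std_gaussian :: (real ^ 'a) measure) (space std_gaussian) = 1" .
qed

section \<open>Fourier and Laplace transforms of the standard Gaussian\<close>

lemma iexp_sum: "finite A \<Longrightarrow> iexp (\<Sum>i\<in>A. f i) = (\<Prod>i\<in>A. iexp (f i))"
  by (simp add: sum_distrib_left exp_sum)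

lemma integral_iexp_std_gaussian:
  "(\<integral>x. iexp (t \<bullet> x) \<partial>std_gaussian) = complex_of_real (exp (- (norm t)\<^sup>2 / 2))"
proof -
  interpret N: real_distribution std_normal_distribution
    by (rule real_dist_normal_dist)
  have *: "(norm t)\<^sup>2 = (\<Sum>b\<in>Basis. (t \<bullet> b)\<^sup>2)"
    unfolding power2_norm_eq_inner by (subst euclidean_inner) (simp add: power2_eq_square)
  have "(\<integral>x. iexp (t \<bullet> x) \<partial>std_gaussian)
      = (\<integral>x. (\<Prod>b\<in>Basis. iexp ((t \<bullet> b) * (x \<bullet> b))) \<partial>std_gaussian)"
    by (intro Bochner_Integration.integral_cong refl, subst euclidean_inner, subst iexp_sum) simp_all
  also have "\<dots> = (\<Prod>b\<in>Basis. char std_normal_distribution (t \<bullet> b))"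
    unfolding char_def by (intro integral_std_gaussian_prod N.integrable_iexp) auto
  also have "\<dots> = complex_of_real (exp (- (norm t)\<^sup>2 / 2))"
    by (simp add: char_std_normal_distribution * sum_divide_distrib exp_sum flip: of_real_prod sum_negf)
  finally show ?thesis .
qed

lemma integral_exp_square_std_normal:
  assumes "a \<ge> 0"
  shows "(\<integral>x. exp (- a * x\<^sup>2 / 2) \<partial>std_normal_distribution) = 1 / sqrt (1 + a)"
proof -
  \<comment> \<open>Adding the exponents gives, up to a constant factor, the density of a centered
    normal law with variance \<open>1 / (1 + a)\<close>, whose integral is 1.\<close>
  have *: "std_normal_density x * exp (- a * x\<^sup>2 / 2)
      = (1 / sqrt (1 + a)) * normal_density 0 (1 / sqrt (1 + a)) x" for x
  proof -
    have "exp (- x\<^sup>2 / 2) * exp (- a * x\<^sup>2 / 2) = exp (- (1 + a) * x\<^sup>2 / 2)"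
      by (simp add: exp_add[symmetric] field_simps)
    then show ?thesis
      using assms
      by (simp add: normal_density_def power_divide real_sqrt_divide real_sqrt_mult field_simps)
  qed
  show ?thesis
    using assms by (subst integral_density) (simp_all only: real_scaleR_def *, simp_all)
qed

lemma integral_exp_norm_square_std_gaussian:
  assumes "a \<ge> 0"
  shows "(\<integral>x. exp (- a * (norm x)\<^sup>2 / 2) \<partial>(std_gaussian :: (real ^ 'd) measure))
    = (1 / sqrt (1 + a)) ^ CARD('d)"
proof -
  interpret N: real_distribution std_normal_distribution
    by (rule real_dist_normal_dist)
  have *: "(norm x)\<^sup>2 = (\<Sum>b\<in>Basis. (x \<bullet> b)\<^sup>2)" for x :: "real ^ 'd"
    unfolding power2_norm_eq_inner by (subst euclidean_inner) (simp add: power2_eq_square)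
  have "(\<integral>x. exp (- a * (norm x)\<^sup>2 / 2) \<partial>(std_gaussian :: (real ^ 'd) measure))
      = (\<integral>x. (\<Prod>b\<in>Basis. exp (- a * (x \<bullet> b)\<^sup>2 / 2)) \<partial>(std_gaussian :: (real ^ 'd) measure))"
    by (simp add: * sum_distrib_left sum_divide_distrib sum_negf flip: exp_sum)
  also have "\<dots> = (\<Prod>b\<in>(Basis :: (real ^ 'd) set).
      \<integral>x. exp (- a * x\<^sup>2 / 2) \<partial>std_normal_distribution)"
    using assms
    by (intro integral_std_gaussian_prod N.integrable_const_bound[where B = 1]) auto
  also have "\<dots> = (1 / sqrt (1 + a)) ^ CARD('d)"
    by (subst integral_exp_square_std_normal[OF assms]) simp
  finally show ?thesis .
qed

section \<open>Lower tail of the norm of a sum of Gaussian vectors\<close>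

context prob_space
begin

lemma expectation_exp_norm_square_sum_std_gaussian:
  fixes g :: "nat \<Rightarrow> 'a \<Rightarrow> real ^ 'd" and a :: real
  assumes "indep_vars (\<lambda>_. borel) g I" "finite I" "a \<ge> 0"
    and "\<And>i. i \<in> I \<Longrightarrow> distr M borel (g i) = std_gaussian"
  shows "expectation (\<lambda>\<omega>. exp (- a * (norm (\<Sum>i\<in>I. g i \<omega>))\<^sup>2 / 2))
    = (1 / sqrt (1 + card I * a)) ^ CARD('d)"
proof -
  let ?S = "\<lambda>\<omega>. \<Sum>i\<in>I. g i \<omega>"
  let ?\<gamma> = "std_gaussian :: (real ^ 'd) measure"
  interpret G: prob_space ?\<gamma>
    by (rule prob_space_std_gaussian)
  interpret P: pair_prob_space M ?\<gamma> ..
  have g [measurable]: "g i \<in> borel_measurable M" if "i \<in> I" for i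
    using assms(1) that by (simp add: indep_vars_def)
  have fubini: "integrable (M \<Otimes>\<^sub>M ?\<gamma>) (\<lambda>(\<omega>, h). iexp ((sqrt a *\<^sub>R ?S \<omega>) \<bullet> h))"
    by (rule P.integrable_const_bound[where B = 1]) auto
  \<comment> \<open>For fixed \<open>h\<close> the expectation is again a Gaussian function, with
    \<open>a\<close> scaled by \<open>card I\<close>; the remaining integral over \<open>h\<close>
    is then the Laplace transform of the squared norm of a single Gaussian vector.\<close>
  have inner: "(\<integral>\<omega>. iexp ((sqrt a *\<^sub>R ?S \<omega>) \<bullet> h) \<partial>M) = exp (- (card I * a) * (norm h)\<^sup>2 / 2)"
    for h :: "real ^ 'd"
  proof -
    have "(\<integral>\<omega>. iexp ((sqrt a *\<^sub>R ?S \<omega>) \<bullet> h) \<partial>M)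
        = (\<integral>\<omega>. (\<Prod>i\<in>I. iexp ((sqrt a *\<^sub>R h) \<bullet> g i \<omega>)) \<partial>M)"
      using assms(2)
      by (simp add: inner_sum_left inner_commute[of h] sum_distrib_left exp_sum)
    also have "\<dots> = (\<Prod>i\<in>I. \<integral>\<omega>. iexp ((sqrt a *\<^sub>R h) \<bullet> g i \<omega>) \<partial>M)"
    proof (rule indep_vars_lebesgue_integral)
      show "indep_vars (\<lambda>_. borel) (\<lambda>i \<omega>. iexp ((sqrt a *\<^sub>R h) \<bullet> g i \<omega>)) I"
        by (rule indep_vars_compose2[OF assms(1)]) simp
      show "integrable M (\<lambda>\<omega>. iexp ((sqrt a *\<^sub>R h) \<bullet> g i \<omega>))" if "i \<in> I" for i
        using that by (intro integrable_const_bound[where B = 1]) auto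
    qed (fact assms(2))
    also have "\<dots> = (\<Prod>i\<in>I. \<integral>x. iexp ((sqrt a *\<^sub>R h) \<bullet> x) \<partial>?\<gamma>)"
      by (intro prod.cong refl, subst assms(4)[symmetric], assumption, subst integral_distr) simp_all
    also have "\<dots> = exp (- (card I * a) * (norm h)\<^sup>2 / 2)"
      using assms(3)
      by (simp only: integral_iexp_std_gaussian)
        (simp add: power_mult_distrib field_simps flip: of_real_power exp_of_nat_mult)
    finally show ?thesis .
  qed
  have "complex_of_real (expectation (\<lambda>\<omega>. exp (- a * (norm (?S \<omega>))\<^sup>2 / 2)))
      = (\<integral>\<omega>. (\<integral>h. iexp ((sqrt a *\<^sub>R ?S \<omega>) \<bullet> h) \<partial>?\<gamma>) \<partial>M)"
    using assms(3) by (simp only: integral_iexp_std_gaussian integral_complex_of_real[symmetric])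
      (simp add: power_mult_distrib)
  also have "\<dots> = (\<integral>h. (\<integral>\<omega>. iexp ((sqrt a *\<^sub>R ?S \<omega>) \<bullet> h) \<partial>M) \<partial>?\<gamma>)"
    using P.Fubini_integral[OF fubini] by simp
  also have "\<dots> = complex_of_real ((1 / sqrt (1 + card I * a)) ^ CARD('d))"
    using assms(3)
    by (simp only: inner integral_complex_of_real integral_exp_norm_square_std_gaussian
        mult_nonneg_nonneg of_nat_0_le_iff)
  finally show ?thesis
    by (simp only: of_real_eq_iff)
qed

text \<open>Chernoff's bound with parameter \<open>a = 3 / card I\<close>. For
  \<open>s = card I * a\<close> the bound per dimension is
  \<open>exp (s / 8) / sqrt (1 + s)\<close>, which is smallest at \<open>s = 3\<close>.\<close>

lemma prob_norm_sum_std_gaussian_less: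
  fixes g :: "nat \<Rightarrow> 'a \<Rightarrow> real ^ 'd"
  assumes "indep_vars (\<lambda>_. borel) g I" "finite I" "I \<noteq> {}"
    and "\<And>i. i \<in> I \<Longrightarrow> distr M borel (g i) = std_gaussian"
    and "r\<^sup>2 \<le> card I * CARD('d) / 4"
  shows "prob {\<omega> \<in> space M. norm (\<Sum>i\<in>I. g i \<omega>) < r} \<le> (exp (3 / 8) / 2) ^ CARD('d)"
proof -
  let ?S = "\<lambda>\<omega>. \<Sum>i\<in>I. g i \<omega>"
  \<comment> \<open>The value of \<open>u\<close> below when the squared norm of the sum equals
    \<open>card I * CARD('d) / 4\<close>, the largest threshold allowed for the square of
    \<open>r\<close>.\<close>
  define c where "c = exp (- 3 / 8 :: real) ^ CARD('d)"
  define u where "u \<omega> = exp (- (3 / card I) * (norm (?S \<omega>))\<^sup>2 / 2)" for \<omega>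
  have pos: "card I > 0"
    using assms(2,3) by (simp add: card_gt_0_iff)
  have g [measurable]: "g i \<in> borel_measurable M" if "i \<in> I" for i
    using assms(1) that by (simp add: indep_vars_def)
  have [measurable]: "u \<in> borel_measurable M"
    unfolding u_def by measurable
  have int: "integrable M u"
    by (rule integrable_const_bound[where B = 1]) (auto simp: u_def)
  have "u \<omega> \<ge> c" if "norm (?S \<omega>) < r" for \<omega>
  proof -
    have "(norm (?S \<omega>))\<^sup>2 \<le> card I * CARD('d) / 4"
      using that assms(5) power_mono[of "norm (?S \<omega>)" r 2] by simp
    then have "real CARD('d) * (- 3 / 8) \<le> - (3 / card I) * (norm (?S \<omega>))\<^sup>2 / 2"
      using pos by (simp add: field_simps)
    then show ?thesis
      by (simp add: c_def u_def flip: exp_of_nat_mult)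
  qed
  then have "prob {\<omega> \<in> space M. norm (?S \<omega>) < r} \<le> prob {\<omega> \<in> space M. u \<omega> \<ge> c}"
    by (intro finite_measure_mono) auto
  also have "\<dots> \<le> expectation u / c"
    by (rule integral_Markov_inequality_measure[OF int, where A = "{}"]) (auto simp: u_def c_def)
  also have "expectation u = (1 / sqrt (1 + card I * (3 / card I))) ^ CARD('d)"
    unfolding u_def using assms by (intro expectation_exp_norm_square_sum_std_gaussian) auto
  also have "\<dots> = (1 / 2) ^ CARD('d)"
    using pos by simp
  also have "(1 / 2) ^ CARD('d) / c = (exp (3 / 8) / 2) ^ CARD('d)"
    by (simp add: c_def power_divide exp_minus field_simps)
  finally show ?thesis .
qed

end

section \<open>Reduction to the norm, and numerical bounds\<close>

text \<open>Cauchy-Schwarz gives one direction, the unit vector \<open>sgn s\<close> the other. This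
  removes the quantifier over \<open>z\<close> from the event, which becomes a visibly measurable
  condition on a norm.\<close>

lemma exists_inner_ge_iff_norm_ge:
  fixes s :: "'a::real_inner"
  assumes "e > 0"
  shows "(\<exists>z. norm z \<le> 1 \<and> \<bar>z \<bullet> s\<bar> \<ge> e) \<longleftrightarrow> norm s \<ge> e"
proof
  assume "\<exists>z. norm z \<le> 1 \<and> \<bar>z \<bullet> s\<bar> \<ge> e"
  then obtain z where z: "norm z \<le> 1" "\<bar>z \<bullet> s\<bar> \<ge> e"
    by blast
  have "\<bar>z \<bullet> s\<bar> \<le> norm z * norm s"
    by (rule Cauchy_Schwarz_ineq2)
  also have "\<dots> \<le> norm s"
    using z(1) by (simp add: mult_left_le_one_le)
  finally show "norm s \<ge> e"
    using z(2) by simp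
next
  assume "norm s \<ge> e"
  moreover from this have "s \<noteq> 0"
    using assms by auto
  ultimately show "\<exists>z. norm z \<le> 1 \<and> \<bar>z \<bullet> s\<bar> \<ge> e"
    by (intro exI[of _ "sgn s"])
      (simp add: norm_sgn, simp add: sgn_div_norm dot_square_norm power2_eq_square field_simps)
qed

text \<open>The degenerate case \<open>v = 0\<close>, a point mass, occurs for
  \<open>z = 0\<close>.\<close>

lemma integral_centered_gaussian_id:
  assumes "v \<ge> 0"
  shows "(\<integral>x. x \<partial>centered_gaussian v) = 0"
proof (cases "v = 0")
  case True
  then show ?thesis
    by (simp add: centered_gaussian_def integral_return)
next
  case False
  then show ?thesis
    using assms integral_normal_moment_nz_1[of "sqrt v" 0]
    by (simp add: centered_gaussian_def integral_density)
qed

lemma exp_three_eighths_half_power_le: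
  assumes "d \<ge> 40"
  shows "(exp (3 / 8) / 2 :: real) ^ d \<le> 1 / 10"
proof -
  \<comment> \<open>The eighth power clears the denominator in the exponent, so that
    \<open>exp 1 \<le> 3\<close> suffices; 40 is five times 8.\<close>
  have "exp (3 / 8 :: real) ^ 8 = exp 1 ^ 3"
    by (simp flip: exp_of_nat_mult)
  also have "\<dots> \<le> 3 ^ 3"
    by (intro power_mono exp_le) simp
  finally have *: "(exp (3 / 8) / 2 :: real) ^ 8 \<le> 27 / 256"
    by (simp add: power_divide)
  then have "(exp (3 / 8) / 2 :: real) ^ 8 \<le> 1 ^ 8"
    by simp
  \<comment> \<open>A base of at most 1 makes the powers decrease in \<open>d\<close>, which leaves
    only \<open>d = 40\<close>.\<close>
  then have "exp (3 / 8) / 2 \<le> (1 :: real)"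
    by (subst (asm) power_mono_iff) auto
  then have "(exp (3 / 8) / 2 :: real) ^ d \<le> (exp (3 / 8) / 2) ^ 40"
    using assms by (intro power_decreasing) auto
  also have "\<dots> = ((exp (3 / 8) / 2) ^ 8) ^ 5"
    by (simp flip: power_mult)
  also have "\<dots> \<le> (27 / 256) ^ 5"
    using * by (intro power_mono) auto
  also have "\<dots> \<le> 1 / 10"
    by (simp add: power_divide)
  finally show ?thesis .
qed

theorem theoremA2:
  fixes M :: "'w measure"
    and g :: "nat \<Rightarrow> 'w \<Rightarrow> real ^ 'd"
    and \<epsilon> :: real
    and n :: nat
  assumes "prob_space M"
    and "CARD('d) \<ge> 40"
    and "0 < \<epsilon>" and "\<epsilon> < 1"
    and "n \<ge> 1"
    and "prob_space.indep_vars M (\<lambda>_. borel) g {1..n}"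
    and "\<And>i. i \<in> {1..n} \<Longrightarrow> distr M borel (g i) = std_gaussian"
  shows "\<exists>f :: real \<Rightarrow> real. 1-lipschitz_on UNIV f \<and>
    (real n \<le> (2 * \<epsilon>) powi (-2) * real CARD('d) \<longrightarrow>
      measure M {\<omega> \<in> space M. \<exists>z :: real ^ 'd. norm z \<le> 1 \<and>
        \<bar>1 / real n * (\<Sum>i = 1..n. f (z \<bullet> g i \<omega>))
          - (LINT x|centered_gaussian ((norm z)\<^sup>2). f x)\<bar> \<ge> \<epsilon>} \<ge> 9 / 10)"
proof (intro exI[of _ "\<lambda>x. x"] conjI impI)
  show "1-lipschitz_on UNIV (\<lambda>x :: real. x)"
    by (rule lipschitz_on_id)
next
  assume n: "real n \<le> (2 * \<epsilon>) powi (-2) * real CARD('d)"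
  interpret prob_space M by fact
  have g [measurable]: "g i \<in> borel_measurable M" if "i \<in> {1..n}" for i
    using assms(6) that by (simp add: indep_vars_def)
  let ?S = "\<lambda>\<omega>. \<Sum>i = 1..n. g i \<omega>"
  \<comment> \<open>Holds for every outcome, by linearity in \<open>z\<close> of the empirical mean.
    The negated form presents the event as the complement of the lower tail.\<close>
  have event: "(\<exists>z :: real ^ 'd. norm z \<le> 1 \<and>
      \<bar>1 / real n * (\<Sum>i = 1..n. z \<bullet> g i \<omega>) - (LINT x|centered_gaussian ((norm z)\<^sup>2). x)\<bar> \<ge> \<epsilon>)
      \<longleftrightarrow> \<not> norm (?S \<omega>) < n * \<epsilon>" for \<omega>
  proof -
    have "1 / real n * (\<Sum>i = 1..n. z \<bullet> g i \<omega>) = z \<bullet> ((1 / real n) *\<^sub>R ?S \<omega>)" for z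
      by (simp add: inner_sum_right)
    then show ?thesis
      using assms(5) exists_inner_ge_iff_norm_ge[OF assms(3), of "(1 / real n) *\<^sub>R ?S \<omega>"]
      by (simp only: integral_centered_gaussian_id zero_le_power2 diff_zero)
        (simp add: field_simps not_less)
  qed
  \<comment> \<open>The bound on \<open>n\<close> with denominators cleared; multiplying it by
    \<open>n / 4\<close> gives the threshold condition of the tail bound for
    \<open>r = n * \<epsilon>\<close>.\<close>
  have "real n * (4 * \<epsilon>\<^sup>2) \<le> CARD('d)"
    using n assms(3) by (simp add: power_int_minus power_mult_distrib field_simps)
  then have "(n * \<epsilon>)\<^sup>2 \<le> card {1..n} * CARD('d) / 4"
    using mult_left_mono[of "real n * (4 * \<epsilon>\<^sup>2)" "CARD('d)" n]
    by (simp add: power_mult_distrib power2_eq_square ac_simps)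
  then have "prob {\<omega> \<in> space M. norm (?S \<omega>) < n * \<epsilon>} \<le> (exp (3 / 8) / 2) ^ CARD('d)"
    using assms(5-7) by (intro prob_norm_sum_std_gaussian_less) auto
  also have "\<dots> \<le> 1 / 10"
    by (rule exp_three_eighths_half_power_le) fact
  finally have "prob {\<omega> \<in> space M. \<not> norm (?S \<omega>) < n * \<epsilon>} \<ge> 9 / 10"
    by (subst prob_neg) auto
  then show "9 / 10 \<le> prob {\<omega> \<in> space M. \<exists>z :: real ^ 'd. norm z \<le> 1 \<and>
      \<bar>1 / real n * (\<Sum>i = 1..n. z \<bullet> g i \<omega>) - (LINT x|centered_gaussian ((norm z)\<^sup>2). x)\<bar> \<ge> \<epsilon>}"
    by (simp only: event)
qed

end
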